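(* For each integer $n\ge 1$ let $V_n:\{0,1,\dots,n\}\to\mathbb R$ be a function such that the finite sequence $\{V_n(r)\}_{r=0}^n$ is unimodal. Put $\Delta_n(r)=V_n(r)-V_n(r-1)$ for $r\in\{1,\dots,n\}$. Suppose there exist a sequence $\{k_n\}_{n\ge1}$ of positive constants and constants $A<0$, $c\in(0,1)$, $\ell\in(0,1)$ such that $D_n(r)=k_n\Delta_n(r)$ satisfies $$\varepsilon_n:=\sup_{\substack{|u|<2\\ \ell n+u\in\{1,\dots,n\}}}\left|D_n(\ell n+u)-A(u-c)\right|\longrightarrow 0\qquad (n\to\infty).$$ Let $r_n^{\mathrm{opt}}$ denote the largest maximizer of $V_n$ over $\{0,\dots,n\}$. Then, for all sufficiently large $n$: 1. $r_n^{\mathrm{opt}}\in\{\lfloor \ell n\rfloor,\lfloor\ell n\rfloor+1\}$; 2. if $\{\ell n\}<1-c-\varepsilon_n/|A|$, then $r_n^{\mathrm{opt}}=\lfloor\ell n\rfloor$; 3. if $\{\ell n\}>1-c+\varepsilon_n/|A|$, then $r_n^{\mathrm{opt}}=\lfloor\ell n\rfloor+1$; 4. consequently, whenever $\left|\{\ell n\}-(1-c)\right|>\varepsilon_n/|A|$, the maximizer of $V_n$ is unique and $r_n^{\mathrm{opt}}=\lfloor\ell n+c\rfloor$.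
   Context: A finite real sequence $\{V(r)\}_{r=0}^n$ is unimodal if there exist $0\le a\le b\le n$ with $V(0)\le\cdots\le V(a)=\cdots=V(b)\ge\cdots\ge V(n)$. The supremum defining $\varepsilon_n$ is over real $u$ with $|u|<2$ such that $\ell n+u$ is an integer in $\{1,\dots,n\}$. For real $x$, $\{x\}=x-\lfloor x\rfloor\in[0,1)$ is the fractional part. *)

theory Defs
  imports Complex_Main
begin

text \<open>
  A finite sequence indexed by \<open>0, \<dots>, n\<close> is a function on \<open>nat\<close>; only its values
  on \<open>{0..n}\<close> are ever used.
\<close>

definition unimodal :: "nat \<Rightarrow> (nat \<Rightarrow> real) \<Rightarrow> bool" where
  "unimodal n V \<longleftrightarrow>
     (\<exists>a b. a \<le> b \<and> b \<le> n \<and>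
        mono_on {0..a} V \<and> (\<forall>r\<in>{a..b}. V r = V a) \<and> antimono_on {b..n} V)"

text \<open>Meaningful for \<open>r \<ge> 1\<close> only, since subtraction on \<open>nat\<close> truncates.\<close>

definition Delta :: "(nat \<Rightarrow> real) \<Rightarrow> nat \<Rightarrow> real" where
  "Delta V r = V r - V (r - 1)"

text \<open>
  The index \<open>l n + u\<close> at which \<open>D\<close> is evaluated is named \<open>r\<close>.  For \<open>n \<ge> 1\<close> and
  \<open>0 < l < 1\<close> the set is finite and nonempty (take \<open>r = \<lceil>l n\<rceil>\<close>), so the
  real supremum is the intended one.
\<close>

definition linear_error :: "(nat \<Rightarrow> real) \<Rightarrow> real \<Rightarrow> real \<Rightarrow> real \<Rightarrow> nat \<Rightarrow> real" where
  "linear_error D A c l n =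
     Sup {\<bar>D r - A * (u - c)\<bar> | u r.
            \<bar>u\<bar> < 2 \<and> r \<in> {1..n} \<and> l * real n + u = real r}"

definition maximizers :: "nat \<Rightarrow> (nat \<Rightarrow> real) \<Rightarrow> nat set" where
  "maximizers n V = {r \<in> {0..n}. \<forall>s\<in>{0..n}. V s \<le> V r}"

definition r_opt :: "nat \<Rightarrow> (nat \<Rightarrow> real) \<Rightarrow> nat" where
  "r_opt n V = Max (maximizers n V)"

end

theory Submission
  imports Defs
begin

text \<open>
  Put \<open>m = \<lfloor>l n\<rfloor>\<close> and \<open>f = {l n}\<close>. At \<open>r = m + j\<close> the linear model gives
  \<open>D(r) \<approx> A (j - f - c)\<close>, which for small error is positive at \<open>j = 0\<close> and negative at \<open>j = 2\<close>;
  unimodality then confines the maximizers to \<open>{m, m + 1}\<close>, and the sign at \<open>j = 1\<close> decides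
  between the two. If \<open>f = 0\<close> then \<open>j = 2\<close> falls outside the window \<open>|u| < 2\<close>, but in this case
  the model is already negative at \<open>j = 1\<close>.
\<close>

text \<open>A strict increase from \<open>r\<close> to \<open>Suc r\<close> can lie neither on the
  plateau \<open>{a..b}\<close> nor on the antimonotone tail. Hence \<open>r < a\<close>, and
  everything up to \<open>r\<close> lies on the monotone part.\<close>

lemma unimodal_before_strict_increase:
  assumes "unimodal n V" "V r < V (Suc r)" "Suc r \<le> n" "s \<le> r"
  shows "V s \<le> V r"
proof -
  obtain a b where ab: "a \<le> b" "b \<le> n" "mono_on {0..a} V"
      "\<forall>r\<in>{a..b}. V r = V a" "antimono_on {b..n} V"
    using assms(1) unfolding unimodal_def by blast
  have "r < b"
    using monotone_onD[OF ab(5), of r "Suc r"] assms(2,3) by force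
  moreover have "\<not> (a \<le> r \<and> Suc r \<le> b)"
    using ab(4)[rule_format, of r] ab(4)[rule_format, of "Suc r"] assms(2) by auto
  ultimately have "r < a"
    by linarith
  then show ?thesis
    using mono_onD[OF ab(3), of s r] assms(4) by simp
qed

text \<open>Mirror image of the previous argument: a strict decrease forces
  \<open>b \<le> r\<close>, so the indices from \<open>Suc r\<close> on lie on the antimonotone
  part.\<close>

lemma unimodal_after_strict_decrease:
  assumes "unimodal n V" "V (Suc r) < V r" "Suc r \<le> s" "s \<le> n"
  shows "V s \<le> V (Suc r)"
proof -
  obtain a b where ab: "a \<le> b" "b \<le> n" "mono_on {0..a} V"
      "\<forall>r\<in>{a..b}. V r = V a" "antimono_on {b..n} V"
    using assms(1) unfolding unimodal_def by blast
  have "a \<le> r"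
    using mono_onD[OF ab(3), of r "Suc r"] assms(2) by force
  moreover have "\<not> (a \<le> r \<and> Suc r \<le> b)"
    using ab(4)[rule_format, of r] ab(4)[rule_format, of "Suc r"] assms(2) by auto
  ultimately have "b \<le> r"
    by linarith
  then show ?thesis
    using monotone_onD[OF ab(5), of "Suc r" s] assms(3,4) by simp
qed

text \<open>A real \<open>Sup\<close> dominates its members only when the set is bounded above. Here
  \<open>u\<close> is determined by \<open>r\<close>, so the set sits inside the image of the finite
  set \<open>{1..n}\<close>.\<close>

lemma le_linear_error:
  assumes "\<bar>u\<bar> < 2" "r \<in> {1..n}" "l * real n + u = real r"
  shows "\<bar>D r - A * (u - c)\<bar> \<le> linear_error D A c l n"
  unfolding linear_error_def
proof (rule cSup_upper)
  let ?S = "{\<bar>D r - A * (u - c)\<bar> | u r. \<bar>u\<bar> < 2 \<and> r \<in> {1..n} \<and> l * real n + u = real r}"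
  show "\<bar>D r - A * (u - c)\<bar> \<in> ?S"
    using assms by blast
  have "?S \<subseteq> (\<lambda>r. \<bar>D r - A * (real r - l * real n - c)\<bar>) ` {1..n}"
  proof
    fix x assume "x \<in> ?S"
    then obtain u r where x: "x = \<bar>D r - A * (u - c)\<bar>" "r \<in> {1..n}" "l * real n + u = real r"
      by blast
    then have "u = real r - l * real n"
      by simp
    with x show "x \<in> (\<lambda>r. \<bar>D r - A * (real r - l * real n - c)\<bar>) ` {1..n}"
      by blast
  qed
  then show "bdd_above ?S"
    by (meson finite_subset finite_imageI finite_atLeastAtMost bdd_above_finite)
qed

lemma maximizersD: "r \<in> maximizers n V \<Longrightarrow> s \<le> n \<Longrightarrow> V s \<le> V r"
  by (simp add: maximizers_def)

lemma maximizers_nonempty: "maximizers n V \<noteq> {}"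
proof -
  have "Max (V ` {0..n}) \<in> V ` {0..n}"
    by (intro Max_in) auto
  then obtain r where "Max (V ` {0..n}) = V r" "r \<in> {0..n}"
    by (rule imageE)
  moreover have "V s \<le> Max (V ` {0..n})" if "s \<in> {0..n}" for s
    using that by (intro Max_ge) auto
  ultimately have "r \<in> maximizers n V"
    by (simp add: maximizers_def)
  then show ?thesis
    by blast
qed

lemma r_opt_in_maximizers: "r_opt n V \<in> maximizers n V"
proof -
  have "finite (maximizers n V)"
    by (simp add: maximizers_def)
  then show ?thesis
    unfolding r_opt_def using maximizers_nonempty by (rule Max_in)
qed

text \<open>An index below \<open>m\<close> has value at most \<open>V (m - 1)\<close>, hence less
  than \<open>V m\<close>; an index above \<open>m + 1\<close> has value at most that at the foot of
  a strict descent. The descent may start at \<open>m\<close> or at \<open>m + 1\<close>, since the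
  linear model controls only the first when \<open>l n\<close> is an integer.\<close>

lemma maximizers_subset_pair:
  assumes "unimodal n V" "1 \<le> m" "m + 2 \<le> n" "V (m - 1) < V m"
    and "V (m + 1) < V m \<or> V (m + 2) < V (m + 1)"
  shows "maximizers n V \<subseteq> {m, m + 1}"
proof
  fix r assume r: "r \<in> maximizers n V"
  note max = maximizersD[OF r]
  have "r \<le> n"
    using r by (simp add: maximizers_def)
  have "m \<le> r"
  proof (rule ccontr)
    assume "\<not> m \<le> r"
    then have "V r \<le> V (m - 1)"
      using unimodal_before_strict_increase[OF assms(1), of "m - 1" r] assms(2-4) by simp
    then show False
      using max[of m] assms(3,4) by simp
  qed
  moreover have "r \<le> m + 1"
  proof (rule ccontr)
    assume "\<not> r \<le> m + 1"
    then have "Suc (Suc m) \<le> r" by simp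
    then show False
      using unimodal_after_strict_decrease[OF assms(1), of m r]
        unimodal_after_strict_decrease[OF assms(1), of "Suc m" r]
        max[of m] max[of "Suc m"] assms(3,5) \<open>r \<le> n\<close> by auto
  qed
  ultimately show "r \<in> {m, m + 1}" by auto
qed

text \<open>The whole argument for one fixed \<open>n\<close>, with the asymptotic requirements
  turned into the hypotheses on \<open>m\<close> and \<open>e\<close>. The last two conclusions are
  equalities of sets, so that they give uniqueness as well as the value.\<close>

lemma maximizers_of_linear_model:
  fixes V :: "nat \<Rightarrow> real" and K :: real and m n :: nat
  assumes "unimodal n V" "K > 0" "A < 0" "0 < c" "c < 1"
    and m: "1 \<le> m" "m + 2 \<le> n" "l * real n = real m + f" and f: "0 \<le> f" "f < 1"
    and e_def: "e = linear_error (\<lambda>r. K * Delta V r) A c l n"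
    and e_small: "e < \<bar>A\<bar> * c" "e < \<bar>A\<bar> * (1 - c)"
  shows "maximizers n V \<subseteq> {m, m + 1}"
    and "f < 1 - c - e / \<bar>A\<bar> \<Longrightarrow> maximizers n V = {m}"
    and "f > 1 - c + e / \<bar>A\<bar> \<Longrightarrow> maximizers n V = {m + 1}"
proof -
  \<comment> \<open>Here \<open>u = j - f\<close>; the bounds on \<open>m\<close> keep
    \<open>m + j\<close> inside \<open>{1..n}\<close>.\<close>
  have err: "\<bar>K * Delta V (m + j) - A * (real j - f - c)\<bar> \<le> e" if "j \<le> 2" "\<bar>real j - f\<bar> < 2" for j
    unfolding e_def using m that by (intro le_linear_error) auto
  have scaled: "K * Delta V r > 0 \<longleftrightarrow> V (r - 1) < V r" "K * Delta V r < 0 \<longleftrightarrow> V r < V (r - 1)" for r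
    using \<open>K > 0\<close> by (auto simp: Delta_def zero_less_mult_iff mult_less_0_iff)
  have err0: "\<bar>K * Delta V m - A * (- f - c)\<bar> \<le> e"
    using err[of 0] f by simp
  have err1: "\<bar>K * Delta V (m + 1) - A * (1 - f - c)\<bar> \<le> e"
    using err[of 1] f by simp
  \<comment> \<open>At \<open>j = 0\<close> the model is \<open>-A * (f + c)\<close>, so dropping
    \<open>f\<close> leaves at least \<open>\<bar>A\<bar> * c\<close>, which exceeds
    \<open>e\<close>.\<close>
  have "A * f \<le> 0"
    using \<open>A < 0\<close> f by (simp add: mult_le_0_iff)
  then have "K * Delta V m > 0"
    using err0 e_small(1) \<open>A < 0\<close> by (simp add: algebra_simps abs_le_iff)
  then have up: "V (m - 1) < V m"
    by (simp add: scaled)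
  \<comment> \<open>Both cases rest on \<open>A * (1 - c) < - e\<close>: this is the model at
    \<open>j = 1\<close> if \<open>f = 0\<close>, and an upper bound for the model at
    \<open>j = 2\<close> if \<open>0 < f < 1\<close>.\<close>
  have down: "V (m + 1) < V m \<or> V (m + 2) < V (m + 1)"
  proof (cases "f = 0")
    case True
    then have "K * Delta V (m + 1) < 0"
      using err1 e_small(2) \<open>A < 0\<close> by (simp add: algebra_simps abs_le_iff)
    then show ?thesis
      by (simp add: scaled)
  next
    case False
    then have "\<bar>K * Delta V (m + 2) - A * (2 - f - c)\<bar> \<le> e"
      using err[of 2] f by simp
    moreover have "A * (2 - f - c) \<le> A * (1 - c)"
      using \<open>A < 0\<close> f by (intro mult_left_mono_neg) auto
    moreover have "\<bar>A\<bar> * (1 - c) = - (A * (1 - c))"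
      using \<open>A < 0\<close> by simp
    ultimately have "K * Delta V (m + 2) < 0"
      using e_small(2) by linarith
    then show ?thesis
      by (simp add: scaled)
  qed
  show sub: "maximizers n V \<subseteq> {m, m + 1}"
    using maximizers_subset_pair assms(1) m(1,2) up down by blast
  show "maximizers n V = {m}" if "f < 1 - c - e / \<bar>A\<bar>"
  proof -
    \<comment> \<open>Scaled by \<open>\<bar>A\<bar>\<close>, the gap condition says that the model
      at \<open>j = 1\<close> lies below \<open>- e\<close>, so the error cannot change its
      sign.\<close>
    have "e < \<bar>A\<bar> * (1 - f - c)"
      using that \<open>A < 0\<close> by (simp add: field_simps)
    then have "K * Delta V (m + 1) < 0"
      using err1 \<open>A < 0\<close> by (simp add: abs_le_iff)
    then have "V (m + 1) < V m"
      by (simp add: scaled)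
    then have "m + 1 \<notin> maximizers n V"
      using maximizersD[of "m + 1" n V m] m(2) by auto
    then show ?thesis
      using sub maximizers_nonempty[of n V] by blast
  qed
  show "maximizers n V = {m + 1}" if "f > 1 - c + e / \<bar>A\<bar>"
  proof -
    have "e < - \<bar>A\<bar> * (1 - f - c)"
      using that \<open>A < 0\<close> by (simp add: field_simps)
    then have "K * Delta V (m + 1) > 0"
      using err1 \<open>A < 0\<close> by (simp add: abs_le_iff)
    then have "V m < V (m + 1)"
      by (simp add: scaled)
    then have "m \<notin> maximizers n V"
      using maximizersD[of m n V "m + 1"] m(2) by auto
    then show ?thesis
      using sub maximizers_nonempty[of n V] by blast
  qed
qed

theorem theorem2p7:
  fixes V :: "nat \<Rightarrow> nat \<Rightarrow> real"
    and k :: "nat \<Rightarrow> real"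
    and A c l :: real
    and D :: "nat \<Rightarrow> nat \<Rightarrow> real"
    and \<epsilon> :: "nat \<Rightarrow> real"
  defines "D \<equiv> \<lambda>n r. k n * Delta (V n) r"
  defines "\<epsilon> \<equiv> \<lambda>n. linear_error (D n) A c l n"
  assumes unimodal: "\<And>n. n \<ge> 1 \<Longrightarrow> unimodal n (V n)"
    and k_pos: "\<And>n. n \<ge> 1 \<Longrightarrow> k n > 0"
    and A_neg: "A < 0"
    and c_bounds: "0 < c" "c < 1"
    and l_bounds: "0 < l" "l < 1"
    and error_tendsto: "\<epsilon> \<longlonglongrightarrow> 0"
  shows "eventually (\<lambda>n.
           int (r_opt n (V n)) \<in> {\<lfloor>l * real n\<rfloor>, \<lfloor>l * real n\<rfloor> + 1} \<and>
           (frac (l * real n) < 1 - c - \<epsilon> n / \<bar>A\<bar> \<longrightarrow>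
              int (r_opt n (V n)) = \<lfloor>l * real n\<rfloor>) \<and>
           (frac (l * real n) > 1 - c + \<epsilon> n / \<bar>A\<bar> \<longrightarrow>
              int (r_opt n (V n)) = \<lfloor>l * real n\<rfloor> + 1) \<and>
           (\<bar>frac (l * real n) - (1 - c)\<bar> > \<epsilon> n / \<bar>A\<bar> \<longrightarrow>
              (\<exists>!r. r \<in> maximizers n (V n)) \<and>
              int (r_opt n (V n)) = \<lfloor>l * real n + c\<rfloor>)) sequentially"
proof -
  \<comment> \<open>Growth of \<open>l * n\<close> yields \<open>1 \<le> m\<close>, and growth of
    \<open>(1 - l) * n\<close> yields \<open>m + 2 \<le> n\<close>.\<close>
  have "filterlim (\<lambda>n. l * real n) at_top sequentially"
    using l_bounds by (simp add: filterlim_tendsto_pos_mult_at_top[OF tendsto_const _ filterlim_real_sequentially])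
  then have ev_m_pos: "\<forall>\<^sub>F n in sequentially. 1 \<le> l * real n"
    by (simp add: filterlim_at_top)
  have "filterlim (\<lambda>n. (1 - l) * real n) at_top sequentially"
    using l_bounds by (simp add: filterlim_tendsto_pos_mult_at_top[OF tendsto_const _ filterlim_real_sequentially])
  then have ev_m_less: "\<forall>\<^sub>F n in sequentially. 2 \<le> (1 - l) * real n"
    by (simp add: filterlim_at_top)
  \<comment> \<open>Both thresholds are positive because \<open>A\<close> is nonzero and
    \<open>c\<close> lies strictly between 0 and 1.\<close>
  have ev_e: "\<forall>\<^sub>F n in sequentially. \<epsilon> n < \<bar>A\<bar> * c" "\<forall>\<^sub>F n in sequentially. \<epsilon> n < \<bar>A\<bar> * (1 - c)"
    by (rule order_tendstoD(2)[OF error_tendsto], use A_neg c_bounds in \<open>simp add: mult_neg_pos\<close>)+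
  show ?thesis
    using ev_m_pos ev_m_less ev_e eventually_ge_at_top[of 1]
  proof eventually_elim
    case (elim n)
    define m where "m = nat \<lfloor>l * real n\<rfloor>"
    define f where "f = frac (l * real n)"
    have int_m: "\<lfloor>l * real n\<rfloor> = int m"
      using elim(1) by (simp add: m_def)
    have mf: "l * real n = real m + f"
      using int_m by (simp add: f_def frac_def)
    have f: "0 \<le> f" "f < 1"
      by (simp_all add: f_def frac_lt_1)
    have "1 \<le> m"
      using mf f elim(1) by linarith
    have "m + 2 \<le> n"
      using mf f(1) elim(2) by (simp add: algebra_simps)
    have "\<epsilon> n = linear_error (\<lambda>r. k n * Delta (V n) r) A c l n"
      by (simp only: \<epsilon>_def D_def)
    note model = maximizers_of_linear_model[OF unimodal[OF elim(5)] k_pos[OF elim(5)] A_neg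
        c_bounds \<open>1 \<le> m\<close> \<open>m + 2 \<le> n\<close> mf f this elim(3,4)]
    note sub = model(1) and lo = model(2) and hi = model(3)
    have opt: "r_opt n (V n) \<in> maximizers n (V n)"
      by (rule r_opt_in_maximizers)
    have gap_case: "(\<exists>!r. r \<in> maximizers n (V n)) \<and> int (r_opt n (V n)) = \<lfloor>l * real n + c\<rfloor>"
      if gap: "\<bar>f - (1 - c)\<bar> > \<epsilon> n / \<bar>A\<bar>"
    \<comment> \<open>The split resolves the absolute value in \<open>gap\<close>. It also fixes the
      floor, as \<open>l * n + c = m + (f + c)\<close> with \<open>f + c\<close> either in
      \<open>[0, 1)\<close> or in \<open>[1, 2)\<close>.\<close>
    proof (cases "f < 1 - c")
      case True
      then have "maximizers n (V n) = {m}"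
        using gap by (intro lo) linarith
      moreover have "\<lfloor>l * real n + c\<rfloor> = int m"
        using True mf f c_bounds by (intro floor_unique) auto
      ultimately show ?thesis
        using opt by auto
    next
      case False
      then have "maximizers n (V n) = {m + 1}"
        using gap by (intro hi) linarith
      moreover have "\<lfloor>l * real n + c\<rfloor> = int (m + 1)"
        using False mf f c_bounds by (intro floor_unique) auto
      ultimately show ?thesis
        using opt by auto
    qed
    have opt_lo: "int (r_opt n (V n)) = int m" if "f < 1 - c - \<epsilon> n / \<bar>A\<bar>"
      using opt lo[OF that] by simp
    have opt_hi: "int (r_opt n (V n)) = int m + 1" if "f > 1 - c + \<epsilon> n / \<bar>A\<bar>"
      using opt hi[OF that] by simp
    have "int (r_opt n (V n)) \<in> {int m, int m + 1}"
      using opt sub by auto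
    then show ?case
      unfolding int_m f_def[symmetric] using opt_lo opt_hi gap_case by blast
  qed
qed

end
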